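(* Let $X$ be a compact CAT(1) space. Suppose the evader wins a discrete-time simple pursuit on $X$ with initial distance $L_0=d(P_0,E_0)<\pi$. Then there is a bilaterally infinite local geodesic $\rho:\mathbb{R}\to X$, any finite segment of which is the limit of segments of the pursuit curve.
   Context: A CAT(1) space is a metric space $(X,d)$ in which any two points at distance $<\pi$ are joined by a geodesic, and in which the distance between any two points of any geodesic triangle of perimeter $<2\pi$ is at most the distance between the corresponding points of the triangle with the same sidelengths in the unit 2-sphere. (Geodesics between points at distance $<\pi$ are then unique.) A geodesic is a curve $\sigma$ with $d(\sigma(t),\sigma(t'))=|t-t'|$ for all parameter values; a local geodesic is a curve that is a geodesic when restricted to some neighborhood of each of its parameter values. Discrete-time simple pursuit with step size $D>0$: a pursuer $P$ and an evader $E$ start at $P_0,E_0\in X$. At the $i$-th step ($i\ge1$) the evader moves from $E_{i-1}$ to a point $E_i$ of its choice with $d(E_{i-1},E_i)\le D$, and the pursuer moves to $P_i$, the point at distance $D$ from $P_{i-1}$ on the geodesic from $P_{i-1}$ to $E_{i-1}$. Play ends with a win for the pursuer if $d(P_i,E_i)\le D$ for some $i$. The sequence $L_i=d(P_i,E_i)$ is non-increasing. The evader wins if and only if play continues forever and $\lim_{i\to\infty}L_i>D$. The pursuit curve $P:[0,\infty)\to X$ is the unit-speed curve obtained by joining the successive $P_i$ by geodesic segments, so $P(iD)=P_i$. A (finite) segment of a curve is its restriction to a compact parameter interval; limits of segments are uniform limits of segments parametrized over a common parameter interval. *)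

theory Defs
  imports "HOL-Analysis.Analysis"
begin

text \<open>
  Geodesics are taken with respect to an explicit distance function \<open>d\<close>, so that the same
  notions serve a subset \<open>X\<close> of a metric space (with \<open>dist\<close>) and the unit 2-sphere (with the
  angular metric, which is not the \<open>dist\<close> of the ambient space).
\<close>

definition geodesic_on ::
  "('a \<Rightarrow> 'a \<Rightarrow> real) \<Rightarrow> 'a set \<Rightarrow> real set \<Rightarrow> (real \<Rightarrow> 'a) \<Rightarrow> bool" where
  "geodesic_on d X I \<sigma> \<longleftrightarrow>
     (\<forall>t\<in>I. \<sigma> t \<in> X) \<and> (\<forall>t\<in>I. \<forall>t'\<in>I. d (\<sigma> t) (\<sigma> t') = \<bar>t - t'\<bar>)"

definition local_geodesic_on ::
  "('a \<Rightarrow> 'a \<Rightarrow> real) \<Rightarrow> 'a set \<Rightarrow> real set \<Rightarrow> (real \<Rightarrow> 'a) \<Rightarrow> bool" where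
  "local_geodesic_on d X I \<sigma> \<longleftrightarrow> (\<forall>t\<in>I. \<exists>e>0. geodesic_on d X (I \<inter> ball t e) \<sigma>)"

definition geodesic_between ::
  "('a \<Rightarrow> 'a \<Rightarrow> real) \<Rightarrow> 'a set \<Rightarrow> 'a \<Rightarrow> 'a \<Rightarrow> (real \<Rightarrow> 'a) \<Rightarrow> bool" where
  "geodesic_between d X x y \<sigma> \<longleftrightarrow>
     geodesic_on d X {0..d x y} \<sigma> \<and> \<sigma> 0 = x \<and> \<sigma> (d x y) = y"

text \<open>
  Vertices and sides are indexed by the cyclic three-element type, where \<open>3 + 1 = 1\<close>:
  side \<open>g i\<close> runs from vertex \<open>p i\<close> to vertex \<open>p (i + 1)\<close>.
\<close>

definition geodesic_triangle ::
  "('a \<Rightarrow> 'a \<Rightarrow> real) \<Rightarrow> 'a set \<Rightarrow> (3 \<Rightarrow> 'a) \<Rightarrow> (3 \<Rightarrow> real \<Rightarrow> 'a) \<Rightarrow> bool" where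
  "geodesic_triangle d X p g \<longleftrightarrow> (\<forall>i. geodesic_between d X (p i) (p (i + 1)) (g i))"

definition sphere_dist :: "real^3 \<Rightarrow> real^3 \<Rightarrow> real" where
  "sphere_dist u v = arccos (u \<bullet> v)"

text \<open>
  When the perimeter is less than \<open>2 * pi\<close>, a comparison triangle in the unit 2-sphere exists
  and is unique up to isometry, so quantifying it existentially or universally is the same.
  The point corresponding to \<open>g i s\<close> is the one at the same distance \<open>s\<close> from the start
  of the corresponding side.
\<close>

definition CAT1 :: "'a::metric_space set \<Rightarrow> bool" where
  "CAT1 X \<longleftrightarrow>
     (\<forall>x\<in>X. \<forall>y\<in>X. dist x y < pi \<longrightarrow> (\<exists>\<sigma>. geodesic_between dist X x y \<sigma>)) \<and>
     (\<forall>p g. geodesic_triangle dist X p g \<and> (\<Sum>i\<in>UNIV. dist (p i) (p (i + 1))) < 2 * pi \<longrightarrow>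
        (\<exists>q h. geodesic_triangle sphere_dist (sphere 0 1) q h \<and>
               (\<forall>i. sphere_dist (q i) (q (i + 1)) = dist (p i) (p (i + 1))) \<and>
               (\<forall>i j. \<forall>s\<in>{0..dist (p i) (p (i + 1))}. \<forall>t\<in>{0..dist (p j) (p (j + 1))}.
                  dist (g i s) (g j t) \<le> sphere_dist (h i s) (h j t))))"

text \<open>
  The rules constrain a step only while the game is on, that is, as long as the pursuer has not
  come within distance \<open>D\<close>; the entries after the end of play are irrelevant.
\<close>

definition simple_pursuit ::
  "'a::metric_space set \<Rightarrow> real \<Rightarrow> (nat \<Rightarrow> 'a) \<Rightarrow> (nat \<Rightarrow> 'a) \<Rightarrow> bool" where
  "simple_pursuit X D P E \<longleftrightarrow>
     0 < D \<and> P 0 \<in> X \<and> E 0 \<in> X \<and>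
     (\<forall>i. (\<forall>j\<le>i. D < dist (P j) (E j)) \<longrightarrow>
        E (Suc i) \<in> X \<and> dist (E i) (E (Suc i)) \<le> D \<and>
        (\<exists>\<sigma>. geodesic_between dist X (P i) (E i) \<sigma> \<and> P (Suc i) = \<sigma> D))"

definition evader_wins ::
  "real \<Rightarrow> (nat \<Rightarrow> 'a::metric_space) \<Rightarrow> (nat \<Rightarrow> 'a) \<Rightarrow> bool" where
  "evader_wins D P E \<longleftrightarrow>
     (\<forall>i. D < dist (P i) (E i)) \<and> (\<exists>L>D. (\<lambda>i. dist (P i) (E i)) \<longlonglongrightarrow> L)"

text \<open>Only the values of \<open>c\<close> on \<open>{0..}\<close> matter.\<close>

definition pursuit_curve ::
  "'a::metric_space set \<Rightarrow> real \<Rightarrow> (nat \<Rightarrow> 'a) \<Rightarrow> (real \<Rightarrow> 'a) \<Rightarrow> bool" where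
  "pursuit_curve X D P c \<longleftrightarrow>
     (\<forall>i. c (real i * D) = P i \<and> geodesic_on dist X {real i * D..real (Suc i) * D} c)"

text \<open>
  Segments \<open>c\<close> restricted to \<open>{s n..s n + (b - a)}\<close>, translated to the common
  parameter interval \<open>{a..b}\<close>, converge uniformly to \<open>\<rho>\<close> there.
\<close>

definition limit_of_segments ::
  "(real \<Rightarrow> 'a::metric_space) \<Rightarrow> real \<Rightarrow> real \<Rightarrow> (real \<Rightarrow> 'a) \<Rightarrow> bool" where
  "limit_of_segments c a b \<rho> \<longleftrightarrow>
     (\<exists>s::nat \<Rightarrow> real. (\<forall>n. 0 \<le> s n) \<and>
        uniform_limit {a..b} (\<lambda>n t. c (s n + (t - a))) \<rho> sequentially)"

end

theory Submission
  imports Defs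
begin

text \<open>
  The idea is to pass to a limit of the pursuit itself. Put \<open>L i = dist (P i) (E i)\<close>. Since
  \<open>P (i + 1)\<close> lies on a geodesic from \<open>P i\<close> to \<open>E i\<close>, one has
  \<open>L (i + 1) \<le> dist (P (i + 1)) (E i) + dist (E i) (E (i + 1)) \<le> (L i - D) + D\<close>. As \<open>L\<close>
  converges, both inequalities become equalities in the limit: far out in time the evader runs
  at full speed, directly away from the pursuer.

  Shift time by \<open>n\<close> steps and let \<open>n\<close> tend to infinity. Compactness yields a limit \<open>\<rho>\<close> of the
  shifted pursuit curves and limits \<open>e k\<close> of the evader's positions, for all integers \<open>k\<close>
  (\<open>shifted_pursuit_limit\<close>). In the limiting pursuit the distance from the pursuer
  \<open>\<rho> (k * D)\<close> to \<open>e k\<close> is a constant \<open>L\<close> with \<open>D < L < pi\<close>, and \<open>e k\<close> lies on a geodesic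
  from the next position of the pursuer to \<open>e (k + 1)\<close>.

  Geodesics shorter than \<open>pi\<close> are unique (\<open>CAT1_geodesic_unique\<close>). Hence the geodesic of
  length \<open>L\<close> which the limiting pursuer follows at step \<open>k + 1\<close> begins with the last
  \<open>L - D\<close> of the geodesic of step \<open>k\<close>. So \<open>\<rho>\<close> is a geodesic on each interval
  \<open>{k * D..k * D + L}\<close>, not merely on \<open>{k * D..(k + 1) * D}\<close>; because \<open>D < L\<close>, the
  interiors of these longer intervals cover the line (\<open>straight_pursuit_local_geodesic\<close>).

  The limit is first only pointwise; since all the curves are 1-Lipschitz, it is uniform on
  compact intervals (\<open>uniform_limit_lipschitz_compact\<close>).
\<close>

section \<open>Geodesics\<close>

lemma geodesic_on_subset:
  "geodesic_on d X I \<sigma> \<Longrightarrow> J \<subseteq> I \<Longrightarrow> geodesic_on d X J \<sigma>"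
  unfolding geodesic_on_def by blast

lemma geodesic_on_dist:
  "geodesic_on d X I \<sigma> \<Longrightarrow> s \<in> I \<Longrightarrow> t \<in> I \<Longrightarrow> d (\<sigma> s) (\<sigma> t) = \<bar>s - t\<bar>"
  unfolding geodesic_on_def by blast

lemma geodesic_on_mem:
  "geodesic_on d X I \<sigma> \<Longrightarrow> t \<in> I \<Longrightarrow> \<sigma> t \<in> X"
  unfolding geodesic_on_def by blast

lemma geodesic_between_translate:
  assumes "geodesic_on dist X {a..b} \<sigma>" "a \<le> b"
  shows "geodesic_between dist X (\<sigma> a) (\<sigma> b) (\<lambda>t. \<sigma> (a + t))"
  using assms by (auto simp: geodesic_between_def geodesic_on_def)

lemma geodesic_between_reverse:
  assumes "geodesic_between dist X x y \<sigma>"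
  shows "geodesic_between dist X y x (\<lambda>t. \<sigma> (dist x y - t))"
  using assms by (auto simp: geodesic_between_def geodesic_on_def dist_commute)

lemma geodesic_between_append:
  assumes \<sigma>: "geodesic_between dist X x y \<sigma>" and \<tau>: "geodesic_between dist X y z \<tau>"
    and add: "dist x z = dist x y + dist y z"
  shows "geodesic_between dist X x z (\<lambda>t. if t \<le> dist x y then \<sigma> t else \<tau> (t - dist x y))"
    (is "geodesic_between dist X x z ?\<gamma>")
proof -
  have \<sigma>D: "dist (\<sigma> s) (\<sigma> t) = \<bar>s - t\<bar>" if "s \<in> {0..dist x y}" "t \<in> {0..dist x y}" for s t
    using \<sigma> that unfolding geodesic_between_def geodesic_on_def by blast
  have \<tau>D: "dist (\<tau> s) (\<tau> t) = \<bar>s - t\<bar>" if "s \<in> {0..dist y z}" "t \<in> {0..dist y z}" for s t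
    using \<tau> that unfolding geodesic_between_def geodesic_on_def by blast
  have ends: "\<sigma> 0 = x" "\<sigma> (dist x y) = y" "\<tau> 0 = y" "\<tau> (dist y z) = z"
    using \<sigma> \<tau> by (auto simp: geodesic_between_def)
  \<comment> \<open>A detour at \<open>y\<close> would make the whole path from \<open>x\<close> to \<open>z\<close> longer than \<open>dist x z\<close>.\<close>
  have mixed: "dist (\<sigma> s) (\<tau> t) = dist x y - s + t"
    if st: "s \<in> {0..dist x y}" "t \<in> {0..dist y z}" for s t
  proof -
    have "dist (\<sigma> s) y = dist x y - s" "dist x (\<sigma> s) = s"
      using \<sigma>D[of s "dist x y"] \<sigma>D[of 0 s] st ends by auto
    moreover have "dist y (\<tau> t) = t" "dist (\<tau> t) z = dist y z - t"
      using \<tau>D[of 0 t] \<tau>D[of t "dist y z"] st ends by auto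
    moreover have "dist x z \<le> dist x (\<sigma> s) + dist (\<sigma> s) (\<tau> t) + dist (\<tau> t) z"
      using dist_triangle[of x z "\<sigma> s"] dist_triangle[of "\<sigma> s" z "\<tau> t"] by linarith
    moreover have "dist (\<sigma> s) (\<tau> t) \<le> dist (\<sigma> s) y + dist y (\<tau> t)"
      by (rule dist_triangle)
    ultimately show ?thesis using add by linarith
  qed
  have "?\<gamma> t \<in> X" if "t \<in> {0..dist x z}" for t
    using \<sigma> \<tau> add that unfolding geodesic_between_def geodesic_on_def by auto
  moreover have "dist (?\<gamma> s) (?\<gamma> t) = \<bar>s - t\<bar>" if "s \<in> {0..dist x z}" "t \<in> {0..dist x z}" for s t
  proof -
    consider "s \<le> dist x y" "t \<le> dist x y" | "s > dist x y" "t > dist x y"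
      | "s \<le> dist x y" "t > dist x y" | "s > dist x y" "t \<le> dist x y" by linarith
    then show ?thesis
    proof cases
      case 1 then show ?thesis using \<sigma>D[of s t] that by simp
    next
      case 2 then show ?thesis using \<tau>D[of "s - dist x y" "t - dist x y"] that add by simp
    next
      case 3 then show ?thesis using mixed[of s "t - dist x y"] that add by simp
    next
      case 4 then show ?thesis
        using mixed[of t "s - dist x y"] that add
        by (simp add: dist_commute[of "\<tau> (s - dist x y)" "\<sigma> t"])
    qed
  qed
  moreover have "?\<gamma> 0 = x" using ends(1) by simp
  moreover have "?\<gamma> (dist x z) = z"
  proof (cases "y = z")
    case True
    then show ?thesis using ends(2) by simp
  next
    case False
    then show ?thesis using ends(4) add by simp
  qed
  ultimately show ?thesis by (simp add: geodesic_between_def geodesic_on_def)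
qed

section \<open>Uniqueness of short geodesics\<close>

text \<open>
  On the sphere, a point between two points that are neither equal nor antipodal is determined
  by its distances to them: it is the vector in their span given by spherical linear
  interpolation.
\<close>

lemma spherical_interpolation:
  fixes u v w :: "'v::real_inner"
  assumes "norm u = 1" "norm v = 1" "norm w = 1"
    and uv: "u \<bullet> v = cos (s + r)" and uw: "u \<bullet> w = cos s" and wv: "w \<bullet> v = cos r"
  shows "sin (s + r) *\<^sub>R w = sin r *\<^sub>R u + sin s *\<^sub>R v"
proof -
  have unit: "u \<bullet> u = 1" "v \<bullet> v = 1" "w \<bullet> w = 1"
    using assms(1-3) by (auto simp: norm_eq_1)
  let ?z = "sin (s + r) *\<^sub>R w - sin r *\<^sub>R u - sin s *\<^sub>R v"
  have trig: "(cos s)\<^sup>2 = 1 - (sin s)\<^sup>2" "(cos r)\<^sup>2 = 1 - (sin r)\<^sup>2"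
    by (simp_all add: cos_squared_eq)
  have "?z \<bullet> ?z = (sin (s + r))\<^sup>2 + (sin r)\<^sup>2 + (sin s)\<^sup>2 - 2 * sin (s + r) * sin r * cos s
      - 2 * sin (s + r) * sin s * cos r + 2 * sin r * sin s * cos (s + r)"
    using unit uv uw wv
    by (simp add: inner_diff_left inner_diff_right inner_commute power2_eq_square algebra_simps)
  also have "\<dots> = 0"
    unfolding sin_add cos_add using trig by algebra
  finally have "?z = 0" by (simp only: inner_eq_zero_iff)
  then show ?thesis by (simp add: algebra_simps)
qed

lemma cos_sphere_dist:
  assumes "u \<in> sphere 0 1" "v \<in> sphere 0 1"
  shows "cos (sphere_dist u v) = u \<bullet> v"
proof -
  have "\<bar>u \<bullet> v\<bar> \<le> 1" using Cauchy_Schwarz_ineq2[of u v] assms by simp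
  then show ?thesis by (simp add: sphere_dist_def cos_arccos_abs)
qed

lemma sphere_dist_self:
  assumes "u \<in> sphere 0 1"
  shows "sphere_dist u u = 0"
  using assms by (simp add: sphere_dist_def norm_eq_1)

lemma sphere_dist_eq_0:
  assumes "u \<in> sphere 0 1" "v \<in> sphere 0 1" "sphere_dist u v = 0"
  shows "u = v"
proof -
  have "u \<bullet> v = 1" using cos_sphere_dist[OF assms(1,2)] assms(3) by simp
  moreover have "u \<bullet> u = 1" "v \<bullet> v = 1" using assms by (auto simp: norm_eq_1)
  ultimately have "(u - v) \<bullet> (u - v) = 0"
    by (simp add: inner_diff_left inner_diff_right inner_commute)
  then show ?thesis by simp
qed

lemma sphere_between_unique:
  assumes S: "u \<in> sphere 0 1" "v \<in> sphere 0 1" "w \<in> sphere 0 1" "w' \<in> sphere 0 1"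
    and "sphere_dist u v = s + r" "0 < s + r" "s + r < pi"
    and "sphere_dist u w = s" "sphere_dist w v = r"
    and "sphere_dist u w' = s" "sphere_dist w' v = r"
  shows "w = w'"
proof -
  have "sin (s + r) *\<^sub>R z = sin r *\<^sub>R u + sin s *\<^sub>R v"
    if "z \<in> sphere 0 1" "sphere_dist u z = s" "sphere_dist z v = r" for z
    using that S assms(5) cos_sphere_dist[of u z] cos_sphere_dist[of z v] cos_sphere_dist[of u v]
    by (intro spherical_interpolation) auto
  then have "sin (s + r) *\<^sub>R w = sin (s + r) *\<^sub>R w'" using assms by metis
  moreover have "sin (s + r) > 0" using assms by (intro sin_gt_zero) auto
  ultimately show ?thesis by simp
qed

text \<open>
  Two geodesics with the same ends form, together with a constant side, a degenerate triangle.
  The two long sides of its comparison triangle coincide, so comparison forces the geodesics to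
  coincide.
\<close>

lemma CAT1_geodesic_unique:
  assumes "CAT1 X" and \<sigma>: "geodesic_between dist X x y \<sigma>" and \<tau>: "geodesic_between dist X x y \<tau>"
    and "dist x y < pi" and s: "s \<in> {0..dist x y}"
  shows "\<sigma> s = \<tau> s"
proof (cases "dist x y = 0")
  case True
  then show ?thesis using \<sigma> \<tau> s by (simp add: geodesic_between_def)
next
  case False
  define l where "l = dist x y"
  define p :: "3 \<Rightarrow> 'a" where "p = (\<lambda>i. if i = 1 then x else y)"
  define g :: "3 \<Rightarrow> real \<Rightarrow> 'a"
    where "g = (\<lambda>i. if i = 1 then \<sigma> else if i = 2 then (\<lambda>_. y) else (\<lambda>t. \<tau> (l - t)))"
  have p: "p 1 = x" "p 2 = y" "p 3 = y" by (simp_all add: p_def)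
  have g: "g 1 = \<sigma>" "g 2 = (\<lambda>_. y)" "g 3 = (\<lambda>t. \<tau> (l - t))" by (simp_all add: g_def)
  have cyc: "1 + 1 = (2::3)" "2 + 1 = (3::3)" "3 + 1 = (1::3)" by simp_all
  have "y \<in> X"
    using \<sigma> geodesic_on_mem[of dist X "{0..dist x y}" \<sigma> "dist x y"]
    by (simp add: geodesic_between_def)
  then have "geodesic_between dist X y y (\<lambda>_. y)"
    by (simp add: geodesic_between_def geodesic_on_def)
  then have "geodesic_triangle dist X p g"
    unfolding geodesic_triangle_def forall_3 cyc p g
    using \<sigma> geodesic_between_reverse[OF \<tau>] by (simp add: l_def)
  moreover have "(\<Sum>i\<in>UNIV. dist (p i) (p (i + 1))) < 2 * pi"
    unfolding sum_3 cyc p using assms by (simp add: dist_commute)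
  ultimately obtain q h where tri: "geodesic_triangle sphere_dist (sphere 0 1) q h"
    and len: "\<forall>i. sphere_dist (q i) (q (i + 1)) = dist (p i) (p (i + 1))"
    and cmp: "\<forall>i j. \<forall>s\<in>{0..dist (p i) (p (i + 1))}. \<forall>t\<in>{0..dist (p j) (p (j + 1))}.
        dist (g i s) (g j t) \<le> sphere_dist (h i s) (h j t)"
    using \<open>CAT1 X\<close> unfolding CAT1_def by blast
  have len': "sphere_dist (q 1) (q 2) = l" "sphere_dist (q 2) (q 3) = 0"
      "sphere_dist (q 3) (q 1) = l"
    using len unfolding forall_3 cyc p by (simp_all add: l_def dist_commute)
  have h: "geodesic_between sphere_dist (sphere 0 1) (q 1) (q 2) (h 1)"
      "geodesic_between sphere_dist (sphere 0 1) (q 2) (q 3) (h 2)"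
      "geodesic_between sphere_dist (sphere 0 1) (q 3) (q 1) (h 3)"
    using tri unfolding geodesic_triangle_def forall_3 cyc by simp_all
  note G = h[unfolded geodesic_between_def len']
  have s': "0 \<in> {0..l}" "s \<in> {0..l}" "l - s \<in> {0..l}" "l \<in> {0..l}"
    using s by (auto simp: l_def)
  have mem: "q 1 \<in> sphere 0 1" "q 2 \<in> sphere 0 1" "q 3 \<in> sphere 0 1"
      "h 1 s \<in> sphere 0 1" "h 3 (l - s) \<in> sphere 0 1"
    using G geodesic_on_mem s' by metis+
  have q23: "q 3 = q 2" using sphere_dist_eq_0 mem len' by metis
  have "sphere_dist (q 1) (h 1 s) = s" "sphere_dist (h 1 s) (q 2) = l - s"
    using geodesic_on_dist[OF conjunct1[OF G(1)], of 0 s]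
      geodesic_on_dist[OF conjunct1[OF G(1)], of s l] G(1) s' by auto
  moreover have "sphere_dist (q 1) (h 3 (l - s)) = s" "sphere_dist (h 3 (l - s)) (q 2) = l - s"
    using geodesic_on_dist[OF conjunct1[OF G(3)], of l "l - s"]
      geodesic_on_dist[OF conjunct1[OF G(3)], of "l - s" 0] G(3) s' q23 by auto
  ultimately have "h 1 s = h 3 (l - s)"
    using mem len' False assms(4)
    by (intro sphere_between_unique[of "q 1" "q 2" _ _ s "l - s"]) (auto simp: l_def)
  then have "sphere_dist (h 1 s) (h 3 (l - s)) = 0" using sphere_dist_self mem by metis
  moreover have "dist (g 1 s) (g 3 (l - s)) \<le> sphere_dist (h 1 s) (h 3 (l - s))"
    using cmp[rule_format, of s 1 "l - s" 3] s' unfolding cyc p by (simp add: l_def dist_commute)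
  ultimately show ?thesis by (simp add: g)
qed

section \<open>Straight pursuits\<close>

text \<open>
  In a straight pursuit the evader keeps its distance \<open>L\<close> by running at full speed directly
  away from the pursuer. By uniqueness of geodesics the pursuer's aim never turns: the geodesic
  towards the evader at one step prolongs that of the step before.
\<close>

lemma straight_pursuit_local_geodesic:
  fixes \<rho> :: "real \<Rightarrow> 'a::metric_space" and e :: "int \<Rightarrow> 'a" and D L :: real
  assumes "CAT1 X" "0 < D" "D < L" "L < pi"
    and \<rho>: "\<And>k::int. geodesic_on dist X {k * D..(k + 1) * D} \<rho>"
    and e: "\<And>k. e k \<in> X"
    and pe: "\<And>k::int. dist (\<rho> (k * D)) (e k) = L"
    and p'e: "\<And>k::int. dist (\<rho> ((k + 1) * D)) (e k) = L - D"
    and ee: "\<And>k. dist (e k) (e (k + 1)) = D"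
  shows "local_geodesic_on dist X UNIV \<rho>"
proof -
  define p where "p = (\<lambda>k::int. \<rho> (k * D))"
  have p_in: "p k \<in> X" for k
    using geodesic_on_mem[OF \<rho>[of k], of "k * D"] \<open>0 < D\<close> by (simp add: p_def algebra_simps)
  have pe: "dist (p k) (e k) = L" and p'e: "dist (p (k + 1)) (e k) = L - D" for k
    using pe[of k] p'e[of k] by (simp_all add: p_def)
  have pp: "dist (p k) (p (k + 1)) = D" for k
    using geodesic_on_dist[OF \<rho>[of k], of "k * D" "(k + 1) * D"] \<open>0 < D\<close>
    by (simp add: p_def algebra_simps)
  have geo: "\<exists>\<sigma>. geodesic_between dist X x y \<sigma>" if "x \<in> X" "y \<in> X" "dist x y < pi" for x y
    using \<open>CAT1 X\<close> that unfolding CAT1_def by blast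
  have "\<exists>\<gamma>. geodesic_between dist X (p k) (e k) \<gamma>" for k
    using geo p_in e pe \<open>L < pi\<close> by metis
  then obtain \<gamma> where \<gamma>: "\<And>k. geodesic_between dist X (p k) (e k) (\<gamma> k)" by metis
  have uniq: "\<gamma> k t = \<tau> t"
    if "geodesic_between dist X (p k) (e k) \<tau>" "t \<in> {0..L}" for k \<tau> t
    using CAT1_geodesic_unique[OF \<open>CAT1 X\<close> \<gamma> that(1)] that(2) pe \<open>L < pi\<close> by simp

  have start: "\<gamma> k t = \<rho> (k * D + t)" if "t \<in> {0..D}" for k t
  proof -
    obtain \<tau> where \<tau>: "geodesic_between dist X (p (k + 1)) (e k) \<tau>"
      using geo[OF p_in[of "k + 1"] e[of k]] p'e[of k] \<open>L < pi\<close> \<open>0 < D\<close> by auto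
    have "geodesic_between dist X (p k) (p (k + 1)) (\<lambda>t. \<rho> (k * D + t))"
      using geodesic_between_translate[OF \<rho>[of k]] \<open>0 < D\<close> by (simp add: p_def algebra_simps)
    from uniq[OF geodesic_between_append[OF this \<tau>], of t] show ?thesis
      using that pe[of k] p'e[of k] pp[of k] \<open>D < L\<close> by simp
  qed

  have overlap: "\<gamma> (k + 1) t = \<gamma> k (D + t)" if "t \<in> {0..L - D}" for k t
  proof -
    obtain \<tau> where \<tau>: "geodesic_between dist X (e k) (e (k + 1)) \<tau>"
      using geo[OF e e] ee \<open>D < L\<close> \<open>L < pi\<close> by (metis less_trans)
    have "\<gamma> k D = p (k + 1)" using start[of D k] \<open>0 < D\<close> by (simp add: p_def algebra_simps)
    moreover have "\<gamma> k L = e k" using \<gamma>[of k] pe[of k] by (simp add: geodesic_between_def)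
    moreover have "geodesic_on dist X {D..L} (\<gamma> k)"
      using \<gamma>[of k] pe[of k] \<open>0 < D\<close> by (auto simp: geodesic_between_def intro: geodesic_on_subset)
    ultimately have "geodesic_between dist X (p (k + 1)) (e k) (\<lambda>t. \<gamma> k (D + t))"
      using geodesic_between_translate[of X D L "\<gamma> k"] \<open>D < L\<close> by simp
    from uniq[OF geodesic_between_append[OF this \<tau>], of t] show ?thesis
      using that pe[of "k + 1"] p'e[of k] ee[of k] \<open>0 < D\<close> by simp
  qed

  have follow: "\<gamma> k t = \<rho> (k * D + t)" if "t \<in> {0..L}" "t \<le> real n * D" for n k t
    using that
  proof (induction n arbitrary: k t)
    case 0
    then show ?case using start[of t k] \<open>0 < D\<close> by simp
  next
    case (Suc n)
    show ?case
    proof (cases "t \<le> D")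
      case True
      then show ?thesis using start[of t k] Suc.prems by simp
    next
      case False
      then have "\<gamma> k t = \<gamma> (k + 1) (t - D)" using overlap[of "t - D" k] Suc.prems by simp
      also have "\<dots> = \<rho> ((k + 1) * D + (t - D))"
        using Suc.IH[of "t - D" "k + 1"] Suc.prems False \<open>0 < D\<close> by (simp add: algebra_simps)
      finally show ?thesis by (simp add: algebra_simps)
    qed
  qed
  have long: "geodesic_on dist X {k * D..k * D + L} \<rho>" for k :: int
  proof -
    obtain n where "L / D \<le> real n" using real_arch_simple by blast
    then have "L \<le> real n * D" using \<open>0 < D\<close> by (simp add: field_simps)
    then have eq: "\<rho> t = \<gamma> k (t - k * D)" if "t \<in> {k * D..k * D + L}" for t
      using follow[of "t - k * D" n k] that by simp
    have "geodesic_on dist X {0..L} (\<gamma> k)"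
      using \<gamma>[of k] pe[of k] by (simp add: geodesic_between_def)
    then show ?thesis unfolding geodesic_on_def using eq by simp
  qed

  show ?thesis
    unfolding local_geodesic_on_def
  proof
    fix t :: real
    \<comment> \<open>With this \<open>k\<close> one has \<open>k * D < t \<le> (k + 1) * D < k * D + L\<close>.\<close>
    define k where "k = \<lceil>t / D\<rceil> - 1"
    have "real_of_int k < t / D" "t / D \<le> real_of_int k + 1"
      unfolding k_def by linarith+
    then have k: "k * D < t" "t < k * D + L"
      using \<open>0 < D\<close> \<open>D < L\<close> by (simp_all add: field_simps)
    define \<epsilon> where "\<epsilon> = min (t - k * D) (k * D + L - t)"
    have "\<epsilon> > 0" using k by (simp add: \<epsilon>_def)
    moreover have "UNIV \<inter> ball t \<epsilon> \<subseteq> {k * D..k * D + L}"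
      by (auto simp: \<epsilon>_def dist_real_def)
    ultimately show "\<exists>\<epsilon>>0. geodesic_on dist X (UNIV \<inter> ball t \<epsilon>) \<rho>"
      using geodesic_on_subset[OF long] by blast
  qed
qed

section \<open>Limits of Lipschitz maps\<close>

text \<open>
  Tychonoff's theorem provides a cluster point of a sequence of functions with values in a
  compact set. For an uncountable index set no subsequence need converge to it; a filter finer
  than \<open>sequentially\<close> does the same service, and every limit along the sequence persists along
  the filter.
\<close>

lemma compact_pointwise_cluster_filter:
  fixes f :: "nat \<Rightarrow> 'i \<Rightarrow> 'a::topological_space"
  assumes "compact X" "\<And>n i. f n i \<in> X"
  obtains G g where "G \<le> sequentially" "G \<noteq> bot"
    "\<And>i. g i \<in> X" "\<And>i. ((\<lambda>n. f n i) \<longlongrightarrow> g i) G"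
proof -
  define K :: "('i \<Rightarrow> 'a) set" where "K = PiE UNIV (\<lambda>_. X)"
  have "compact K"
    using compactin_PiE[of "\<lambda>_::'i. euclidean :: 'a topology" UNIV "\<lambda>_. X"] \<open>compact X\<close>
    by (simp add: K_def euclidean_product_topology)
  moreover have "\<forall>\<^sub>F x in filtermap f sequentially. x \<in> K"
    using assms by (simp add: eventually_filtermap K_def PiE_UNIV_domain)
  moreover have "filtermap f sequentially \<noteq> bot" by (simp add: filtermap_bot_iff)
  ultimately obtain g where g: "g \<in> K" "inf (nhds g) (filtermap f sequentially) \<noteq> bot"
    unfolding compact_filter by meson
  define G where "G = inf sequentially (filtercomap f (nhds g))"
  have "G \<noteq> bot"
  proof
    assume "G = bot"
    then obtain Q R where Q: "eventually Q sequentially" and R: "eventually R (nhds g)"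
      and QR: "\<And>n. Q n \<Longrightarrow> R (f n) \<Longrightarrow> False"
      unfolding G_def trivial_limit_def eventually_inf eventually_filtercomap by blast
    have "eventually (\<lambda>x. \<not> R x) (filtermap f sequentially)"
      unfolding eventually_filtermap using Q by (rule eventually_mono) (use QR in blast)
    then have "eventually (\<lambda>_. False) (inf (nhds g) (filtermap f sequentially))"
      unfolding eventually_inf using R by blast
    then show False using g by (simp add: trivial_limit_def)
  qed
  moreover have "G \<le> sequentially" by (simp add: G_def)
  moreover have "g i \<in> X" for i using g by (auto simp: K_def)
  moreover have "((\<lambda>n. f n i) \<longlongrightarrow> g i) G" for i
  proof -
    have "filterlim f (nhds g) G"
      unfolding G_def filterlim_iff_le_filtercomap by simp
    moreover have "filterlim (\<lambda>x. x i) (nhds (g i)) (nhds g)"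
    proof (rule topological_tendstoI)
      fix V assume "open V" "g i \<in> V"
      then have "open ((\<lambda>x. x i) -` V)" "g \<in> (\<lambda>x. x i) -` V"
        by (auto intro: open_vimage)
      then show "\<forall>\<^sub>F x in nhds g. x i \<in> V"
        unfolding eventually_nhds by (intro exI[of _ "(\<lambda>x. x i) -` V"]) simp
    qed
    ultimately show ?thesis by (rule filterlim_compose[rotated])
  qed
  ultimately show thesis using that by blast
qed

lemma uniform_limit_lipschitz_compact:
  fixes f :: "'i \<Rightarrow> 'a::metric_space \<Rightarrow> 'b::metric_space"
  assumes lip: "\<And>n s t. dist (f n s) (f n t) \<le> dist s t"
    and lim: "\<And>t. ((\<lambda>n. f n t) \<longlongrightarrow> g t) F" and "F \<noteq> bot" and "compact S"
  shows "uniform_limit S f g F"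
proof (rule uniform_limitI)
  fix \<epsilon> :: real assume "0 < \<epsilon>"
  have lip_g: "dist (g s) (g t) \<le> dist s t" for s t
    using tendsto_upperbound[OF tendsto_dist[OF lim[of s] lim[of t]]] lip \<open>F \<noteq> bot\<close> by simp
  obtain N where N: "finite N" "S \<subseteq> (\<Union>x\<in>N. ball x (\<epsilon> / 3))"
    using seq_compact_imp_totally_bounded[of S] \<open>compact S\<close> \<open>0 < \<epsilon>\<close>
    by (metis compact_imp_seq_compact divide_pos_pos zero_less_numeral)
  have "\<forall>\<^sub>F n in F. \<forall>x\<in>N. dist (f n x) (g x) < \<epsilon> / 3"
  proof (rule eventually_ball_finite[OF N(1)], rule ballI)
    show "\<forall>\<^sub>F n in F. dist (f n x) (g x) < \<epsilon> / 3" for x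
      using \<open>0 < \<epsilon>\<close> by (intro tendstoD[OF lim]) simp
  qed
  then show "\<forall>\<^sub>F n in F. \<forall>t\<in>S. dist (f n t) (g t) < \<epsilon>"
  proof eventually_elim
    case (elim n)
    show ?case
    proof
      fix t assume "t \<in> S"
      then obtain x where x: "x \<in> N" "dist x t < \<epsilon> / 3" using N(2) by auto
      have "dist (f n t) (g t) \<le> dist (f n t) (f n x) + dist (f n x) (g x) + dist (g x) (g t)"
        using dist_triangle[of "f n t" "g t" "f n x"] dist_triangle[of "f n x" "g t" "g x"]
        by linarith
      moreover have "dist (f n t) (f n x) \<le> dist x t" using lip[of n t x] by (simp add: dist_commute)
      ultimately show "dist (f n t) (g t) < \<epsilon>" using lip_g[of x t] elim x by fastforce
    qed
  qed
qed

section \<open>The pursuit and its limit\<close>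

lemma pursuit_curve_mem:
  assumes "pursuit_curve X D P c" "0 < D" "0 \<le> t"
  shows "c t \<in> X"
proof -
  define i where "i = nat \<lfloor>t / D\<rfloor>"
  have i: "real i = real_of_int \<lfloor>t / D\<rfloor>" using assms by (simp add: i_def)
  then have "real i \<le> t / D" "t / D \<le> real (Suc i)" by linarith+
  then have "t \<in> {real i * D..real (Suc i) * D}"
    using \<open>0 < D\<close> by (simp_all add: field_simps)
  then show ?thesis using assms geodesic_on_mem unfolding pursuit_curve_def by metis
qed

lemma pursuit_curve_lipschitz:
  assumes c: "pursuit_curve X D P c" and "0 < D" and "0 \<le> s" "0 \<le> t"
  shows "dist (c s) (c t) \<le> \<bar>s - t\<bar>"
proof -
  have piece: "dist (c s) (c t) = \<bar>s - t\<bar>"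
    if "s \<in> {real i * D..real (Suc i) * D}" "t \<in> {real i * D..real (Suc i) * D}" for i s t
    using c that geodesic_on_dist unfolding pursuit_curve_def by blast
  have ord: "dist (c s) (c t) \<le> t - s" if "0 \<le> s" "s \<le> t" "t \<le> real n * D" for n s t
    using that
  proof (induction n arbitrary: s t)
    case 0
    then have "s = t" by simp
    with 0 show ?case by simp
  next
    case (Suc n)
    let ?b = "real n * D"
    consider "t \<le> ?b" | "?b \<le> s" | "s \<le> ?b" "?b \<le> t" by linarith
    then show ?case
    proof cases
      case 1
      then show ?thesis using Suc by simp
    next
      case 2
      then show ?thesis using piece[of s n t] Suc.prems by simp
    next
      case 3
      have "dist (c s) (c t) \<le> dist (c s) (c ?b) + dist (c ?b) (c t)" by (rule dist_triangle)
      also have "dist (c s) (c ?b) \<le> ?b - s" using Suc 3 by simp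
      also have "dist (c ?b) (c t) = t - ?b"
        using piece[of ?b n t] Suc.prems 3 \<open>0 < D\<close> by (simp add: algebra_simps)
      finally show ?thesis by simp
    qed
  qed
  obtain n where "max s t / D \<le> real n" using real_arch_simple by blast
  then have "s \<le> real n * D" "t \<le> real n * D" using \<open>0 < D\<close> by (simp_all add: field_simps)
  then show ?thesis
    using ord[of s t n] ord[of t s n] assms(3,4) by (cases "s \<le> t") (auto simp: dist_commute)
qed

lemma pursuit_step:
  assumes "simple_pursuit X D P E" "evader_wins D P E"
  shows "E i \<in> X" "dist (P (Suc i)) (E i) = dist (P i) (E i) - D" "dist (E i) (E (Suc i)) \<le> D"
proof -
  have D: "0 < D" "\<And>i. D < dist (P i) (E i)"
    using assms by (auto simp: simple_pursuit_def evader_wins_def)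
  then have E: "E (Suc i) \<in> X" "dist (E i) (E (Suc i)) \<le> D"
      "\<exists>\<sigma>. geodesic_between dist X (P i) (E i) \<sigma> \<and> P (Suc i) = \<sigma> D" for i
    using assms unfolding simple_pursuit_def by blast+
  show "E i \<in> X" using E(1) assms by (cases i) (auto simp: simple_pursuit_def)
  show "dist (E i) (E (Suc i)) \<le> D" by (rule E)
  obtain \<sigma> where \<sigma>: "geodesic_between dist X (P i) (E i) \<sigma>" "P (Suc i) = \<sigma> D" using E by blast
  let ?l = "dist (P i) (E i)"
  have "dist (\<sigma> D) (\<sigma> ?l) = \<bar>D - ?l\<bar>"
    using geodesic_on_dist[of dist X "{0..?l}" \<sigma> D ?l] \<sigma>(1) D(1) D(2)[of i]
    unfolding geodesic_between_def by simp
  moreover have "\<sigma> ?l = E i" using \<sigma>(1) by (simp add: geodesic_between_def)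
  ultimately show "dist (P (Suc i)) (E i) = ?l - D" using \<sigma>(2) D(2)[of i] by simp
qed

lemma pursuit_distance_antimono:
  assumes "simple_pursuit X D P E" "evader_wins D P E"
  shows "decseq (\<lambda>i. dist (P i) (E i))"
proof (rule decseq_SucI)
  fix i
  show "dist (P (Suc i)) (E (Suc i)) \<le> dist (P i) (E i)"
    using dist_triangle[of "P (Suc i)" "E (Suc i)" "E i"] pursuit_step(2,3)[OF assms, of i]
    by linarith
qed

text \<open>
  The evader's step is at most \<open>D\<close> and at least the gain \<open>L (i + 1) - (L i - D)\<close>, which tends
  to \<open>D\<close> because the distances \<open>L i\<close> converge.
\<close>

lemma pursuit_distance_limits:
  assumes pursuit: "simple_pursuit X D P E" "evader_wins D P E"
    and L: "(\<lambda>i. dist (P i) (E i)) \<longlonglongrightarrow> L"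
  shows "(\<lambda>i. dist (P (Suc i)) (E i)) \<longlonglongrightarrow> L - D" "(\<lambda>i. dist (E i) (E (Suc i))) \<longlonglongrightarrow> D"
proof -
  show "(\<lambda>i. dist (P (Suc i)) (E i)) \<longlonglongrightarrow> L - D"
    unfolding pursuit_step(2)[OF pursuit] by (intro tendsto_intros L)
  have "(\<lambda>i. dist (P (Suc i)) (E (Suc i)) - (dist (P i) (E i) - D)) \<longlonglongrightarrow> L - (L - D)"
    by (intro tendsto_intros L LIMSEQ_Suc[OF L])
  then have low: "(\<lambda>i. dist (P (Suc i)) (E (Suc i)) - (dist (P i) (E i) - D)) \<longlonglongrightarrow> D" by simp
  have "dist (P (Suc i)) (E (Suc i)) - (dist (P i) (E i) - D) \<le> dist (E i) (E (Suc i))" for i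
    using dist_triangle[of "P (Suc i)" "E (Suc i)" "E i"] pursuit_step(2)[OF pursuit, of i]
    by linarith
  then show "(\<lambda>i. dist (E i) (E (Suc i))) \<longlonglongrightarrow> D"
    using pursuit_step(3)[OF pursuit] by (intro tendsto_sandwich[OF _ _ low tendsto_const]) auto
qed

text \<open>
  The pursuit shifted by \<open>n\<close> steps satisfies each of the metric relations below, either exactly
  or up to an error that tends to zero, so that its limit satisfies them all exactly. Shifted
  times are cut off at zero, where the pursuit starts; for a fixed time this has no effect once
  \<open>n\<close> is large.
\<close>

lemma shifted_pursuit_limit:
  fixes X :: "'a::metric_space set" and c :: "real \<Rightarrow> 'a" and D L :: real
  assumes "compact X" and pursuit: "simple_pursuit X D P E" "evader_wins D P E"
    and c: "pursuit_curve X D P c" and L: "(\<lambda>i. dist (P i) (E i)) \<longlonglongrightarrow> L"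
  obtains G and \<rho> :: "real \<Rightarrow> 'a" and e :: "int \<Rightarrow> 'a"
  where "G \<le> sequentially" "G \<noteq> bot"
    "\<And>t. ((\<lambda>n. c (max 0 (real n * D + t))) \<longlongrightarrow> \<rho> t) G"
    "\<And>k. e k \<in> X"
    "\<And>k::int. geodesic_on dist X {k * D..(k + 1) * D} \<rho>"
    "\<And>k::int. dist (\<rho> (k * D)) (e k) = L"
    "\<And>k::int. dist (\<rho> ((k + 1) * D)) (e k) = L - D"
    "\<And>k. dist (e k) (e (k + 1)) = D"
proof -
  have "0 < D" using pursuit by (simp add: simple_pursuit_def)
  \<comment> \<open>The sum type lets both families converge along the same filter.\<close>
  define f :: "nat \<Rightarrow> real + int \<Rightarrow> 'a"
    where "f n = case_sum (\<lambda>t. c (max 0 (real n * D + t))) (\<lambda>k. E (nat (int n + k)))" for n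
  have "f n x \<in> X" for n x
    using pursuit_curve_mem[OF c \<open>0 < D\<close>] pursuit_step(1)[OF pursuit]
    by (cases x) (auto simp: f_def)
  then obtain G g where G: "G \<le> sequentially" "G \<noteq> bot" and g: "\<And>x. g x \<in> X"
    and lim: "\<And>x. ((\<lambda>n. f n x) \<longlongrightarrow> g x) G"
    using compact_pointwise_cluster_filter[OF \<open>compact X\<close>, of f] by blast
  define \<rho> where "\<rho> t = g (Inl t)" for t
  define e where "e k = g (Inr k)" for k
  have \<rho>: "((\<lambda>n. c (max 0 (real n * D + t))) \<longlongrightarrow> \<rho> t) G" for t
    using lim[of "Inl t"] by (simp add: f_def \<rho>_def)
  have e: "((\<lambda>n. E (nat (int n + k))) \<longlongrightarrow> e k) G" for k
    using lim[of "Inr k"] by (simp add: f_def e_def)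
  have late: "\<forall>\<^sub>F n in G. 0 \<le> int n + k" for k
  proof -
    have "\<forall>\<^sub>F n in sequentially. 0 \<le> int n + k"
      using eventually_ge_at_top[of "nat (- k)"] by eventually_elim linarith
    then show ?thesis using G(1) by (rule filter_leD[rotated])
  qed
  have shift: "filterlim (\<lambda>n. nat (int n + k)) sequentially G" for k
  proof -
    have "filterlim (\<lambda>n. nat (int n + k)) sequentially sequentially"
      unfolding filterlim_at_top
    proof
      fix m
      show "\<forall>\<^sub>F n in sequentially. m \<le> nat (int n + k)"
        using eventually_ge_at_top[of "m + nat (- k)"] by eventually_elim linarith
    qed
    then show ?thesis using order_refl G(1) by (rule filterlim_mono)
  qed
  have P: "((\<lambda>n. P (nat (int n + k))) \<longlongrightarrow> \<rho> (k * D)) G" for k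
  proof (rule Lim_transform_eventually[OF \<rho>])
    show "\<forall>\<^sub>F n in G. c (max 0 (real n * D + k * D)) = P (nat (int n + k))"
      using late[of k]
    proof eventually_elim
      case (elim n)
      then have "real n * D + k * D = real (nat (int n + k)) * D" by (simp add: algebra_simps)
      moreover have "c (real (nat (int n + k)) * D) = P (nat (int n + k))"
        using c by (simp add: pursuit_curve_def)
      ultimately show ?case using \<open>0 < D\<close> by simp
    qed
  qed
  have suc: "\<forall>\<^sub>F n in G. nat (int n + (k + 1)) = Suc (nat (int n + k))" for k
    using late[of k] by eventually_elim linarith
  have "dist (\<rho> (k * D)) (e k) = L" for k :: int
    by (rule tendsto_unique[OF G(2) tendsto_dist[OF P e]])
       (rule filterlim_compose[OF L shift])
  moreover have "dist (\<rho> ((k + 1) * D)) (e k) = L - D" for k :: int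
  proof -
    have "((\<lambda>n. dist (P (nat (int n + (k + 1)))) (E (nat (int n + k)))) \<longlongrightarrow> L - D) G"
      by (rule Lim_transform_eventually
          [OF filterlim_compose[OF pursuit_distance_limits(1)[OF pursuit L] shift[of k]]])
         (use suc[of k] in eventually_elim, simp)
    from tendsto_unique[OF G(2) tendsto_dist[OF P[of "k + 1"] e[of k]] this]
    show ?thesis by simp
  qed
  moreover have "dist (e k) (e (k + 1)) = D" for k
  proof -
    have "((\<lambda>n. dist (E (nat (int n + k))) (E (nat (int n + (k + 1))))) \<longlongrightarrow> D) G"
      by (rule Lim_transform_eventually
          [OF filterlim_compose[OF pursuit_distance_limits(2)[OF pursuit L] shift[of k]]])
         (use suc[of k] in eventually_elim, simp)
    from tendsto_unique[OF G(2) tendsto_dist[OF e[of k] e[of "k + 1"]] this]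
    show ?thesis .
  qed
  moreover have "geodesic_on dist X {k * D..(k + 1) * D} \<rho>" for k :: int
    unfolding geodesic_on_def
  proof (intro conjI ballI)
    show "\<rho> t \<in> X" for t using g by (simp add: \<rho>_def)
    fix s t :: real
    assume st: "s \<in> {k * D..(k + 1) * D}" "t \<in> {k * D..(k + 1) * D}"
    have "\<forall>\<^sub>F n in G. dist (c (max 0 (real n * D + s))) (c (max 0 (real n * D + t))) = \<bar>s - t\<bar>"
      using late[of k]
    proof eventually_elim
      case (elim n)
      define i where "i = nat (int n + k)"
      have i: "real i = real n + k" using elim by (simp add: i_def)
      have "geodesic_on dist X {real i * D..real (Suc i) * D} c"
        using c by (simp add: pursuit_curve_def)
      moreover have "real n * D + s \<in> {real i * D..real (Suc i) * D}"
          "real n * D + t \<in> {real i * D..real (Suc i) * D}"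
        using st i by (auto simp: algebra_simps)
      moreover have "0 \<le> real i * D" using \<open>0 < D\<close> by simp
      ultimately show ?case
        using geodesic_on_dist[of dist X _ c "real n * D + s" "real n * D + t"]
        by (auto simp: max_def)
    qed
    then have "((\<lambda>n. dist (c (max 0 (real n * D + s))) (c (max 0 (real n * D + t))))
        \<longlongrightarrow> \<bar>s - t\<bar>) G"
      by (rule tendsto_eventually)
    from tendsto_unique[OF G(2) tendsto_dist[OF \<rho> \<rho>] this]
    show "dist (\<rho> s) (\<rho> t) = \<bar>s - t\<bar>" .
  qed
  ultimately show thesis using that[OF G \<rho>, of e] g by (simp add: e_def)
qed

theorem proposition16:
  fixes X :: "'a::metric_space set" and D :: real
    and P E :: "nat \<Rightarrow> 'a" and c :: "real \<Rightarrow> 'a"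
  assumes "compact X" and "CAT1 X"
    and "simple_pursuit X D P E"
    and "evader_wins D P E"
    and "dist (P 0) (E 0) < pi"
    and "pursuit_curve X D P c"
  shows "\<exists>\<rho>::real \<Rightarrow> 'a. local_geodesic_on dist X UNIV \<rho> \<and>
           (\<forall>a b. a \<le> b \<longrightarrow> limit_of_segments c a b \<rho>)"
proof -
  note pursuit = assms(3,4)
  have "0 < D" using pursuit by (simp add: simple_pursuit_def)
  obtain L where L: "D < L" "(\<lambda>i. dist (P i) (E i)) \<longlonglongrightarrow> L"
    using pursuit(2) by (auto simp: evader_wins_def)
  have "L \<le> dist (P 0) (E 0)"
    using decseq_ge[OF pursuit_distance_antimono[OF pursuit] L(2), of 0] .
  then have "L < pi" using assms(5) by simp
  obtain G \<rho> and e :: "int \<Rightarrow> 'a" where G: "G \<le> sequentially" "G \<noteq> bot"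
    and lim: "\<And>t. ((\<lambda>n. c (max 0 (real n * D + t))) \<longlongrightarrow> \<rho> t) G"
    and straight: "\<And>k. e k \<in> X" "\<And>k::int. geodesic_on dist X {k * D..(k + 1) * D} \<rho>"
      "\<And>k::int. dist (\<rho> (k * D)) (e k) = L" "\<And>k::int. dist (\<rho> ((k + 1) * D)) (e k) = L - D"
      "\<And>k. dist (e k) (e (k + 1)) = D"
    by (rule shifted_pursuit_limit[OF \<open>compact X\<close> pursuit assms(6) L(2)]) (rule that)
  have "local_geodesic_on dist X UNIV \<rho>"
    by (rule straight_pursuit_local_geodesic[OF \<open>CAT1 X\<close> \<open>0 < D\<close> L(1) \<open>L < pi\<close>
        straight(2,1,3,4,5)])
  moreover have "limit_of_segments c a b \<rho>" for a b
  proof -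
    define f where "f n t = c (max 0 (real n * D + t))" for n t
    have lip: "dist (f n s) (f n t) \<le> dist s t" for n s t
    proof -
      have "dist (f n s) (f n t) \<le> \<bar>max 0 (real n * D + s) - max 0 (real n * D + t)\<bar>"
        unfolding f_def by (rule pursuit_curve_lipschitz[OF assms(6) \<open>0 < D\<close>]) simp_all
      also have "\<dots> \<le> dist s t" unfolding dist_real_def by linarith
      finally show ?thesis .
    qed
    have unif: "uniform_limit {a..b} f \<rho> G"
      using lip lim G(2) by (intro uniform_limit_lipschitz_compact) (auto simp: f_def)
    have late: "\<forall>\<^sub>F n in G. 0 \<le> real n * D + a"
    proof -
      have "\<forall>\<^sub>F n in sequentially. 0 \<le> real n * D + a"
        using eventually_ge_at_top[of "nat \<lceil>- a / D\<rceil>"]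
      proof eventually_elim
        case (elim n)
        then have "- a / D \<le> real n" by linarith
        then show ?case using \<open>0 < D\<close> by (simp add: field_simps)
      qed
      then show ?thesis using G(1) by (rule filter_leD[rotated])
    qed
    \<comment> \<open>Choosing one shift for each accuracy \<open>1 / (m + 1)\<close> turns the filter back into a sequence.\<close>
    have "\<exists>n. 0 \<le> real n * D + a \<and> (\<forall>t\<in>{a..b}. dist (f n t) (\<rho> t) < inverse (real (Suc m)))" for m
    proof -
      have "\<forall>\<^sub>F n in G. \<forall>t\<in>{a..b}. dist (f n t) (\<rho> t) < inverse (real (Suc m))"
        by (rule uniform_limitD[OF unif]) simp
      with late have "\<forall>\<^sub>F n in G. 0 \<le> real n * D + a \<and>
          (\<forall>t\<in>{a..b}. dist (f n t) (\<rho> t) < inverse (real (Suc m)))"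
        by (rule eventually_conj)
      then show ?thesis by (rule eventually_happens'[OF G(2)])
    qed
    then obtain N where N: "\<And>m. 0 \<le> real (N m) * D + a"
      and close: "\<And>m t. t \<in> {a..b} \<Longrightarrow> dist (f (N m) t) (\<rho> t) < inverse (real (Suc m))"
      by metis
    have "uniform_limit {a..b} (\<lambda>m t. c (real (N m) * D + a + (t - a))) \<rho> sequentially"
    proof (rule uniform_limitI)
      fix \<epsilon> :: real assume "0 < \<epsilon>"
      then have "\<forall>\<^sub>F m in sequentially. inverse (real (Suc m)) < \<epsilon>"
        using LIMSEQ_inverse_real_of_nat by (rule order_tendstoD(2)[rotated])
      then show "\<forall>\<^sub>F m in sequentially. \<forall>t\<in>{a..b}.
          dist (c (real (N m) * D + a + (t - a))) (\<rho> t) < \<epsilon>"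
      proof eventually_elim
        case (elim m)
        show ?case
        proof
          fix t assume t: "t \<in> {a..b}"
          then have "f (N m) t = c (real (N m) * D + a + (t - a))"
            using N[of m] by (simp add: f_def max_def)
          then show "dist (c (real (N m) * D + a + (t - a))) (\<rho> t) < \<epsilon>"
            using close[OF t, of m] elim by simp
        qed
      qed
    qed
    then show ?thesis
      unfolding limit_of_segments_def
      by (intro exI[of _ "\<lambda>m. real (N m) * D + a"] conjI allI N)
  qed
  ultimately show ?thesis by blast
qed

end
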